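(* Let $D>0$, $h>0$, $\bar\gamma>0$ and $R_{th}\ge 0$. Let $x_1,y_1,x_2,y_2$ be independent random variables, each uniformly distributed on $[-\frac D2,\frac D2]$. Define $$\gamma_B=\frac{\bar\gamma}{y_1^2+h^2},\quad \gamma_E=\frac{\bar\gamma}{(x_1-x_2)^2+y_2^2+h^2},\quad \hat\gamma_B=\frac{\bar\gamma}{x_1^2+y_1^2+h^2},\quad \hat\gamma_E=\frac{\bar\gamma}{x_2^2+y_2^2+h^2},$$ and the secrecy outage probabilities $$\mathcal P_{so}=\mathrm{Pr}\left(\log_2(1+\gamma_B)-\log_2(1+\gamma_E)\le R_{th}\right),\qquad \hat{\mathcal P}_{so}=\mathrm{Pr}\left(\log_2(1+\hat\gamma_B)-\log_2(1+\hat\gamma_E)\le R_{th}\right).$$ Then $$\mathcal P_{so}\ \ge\ \frac{2\pi-1}{24}\qquad\text{and}\qquad \hat{\mathcal P}_{so}\ \ge\ \frac12 .$$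
   Context: Setting: a base station serves a legitimate user (Bob) at $(x_1,y_1,0)$ in the presence of an eavesdropper (Eve) at $(x_2,y_2,0)$. $\mathcal P_{so}$ is the secrecy outage probability (SOP) of the pinching-antenna system, in which the antenna is activated at $(x_1,0,h)$, the point of the waveguide closest to Bob; $\hat{\mathcal P}_{so}$ is the SOP of the conventional fixed-position antenna (FPA) system, in which the antenna is at $(0,0,h)$. $\gamma_B,\gamma_E$ (resp. $\hat\gamma_B,\hat\gamma_E$) are the corresponding signal-to-noise ratios at Bob and Eve, $\bar\gamma$ is the effective transmit SNR (proportional to the transmit power), and $R_{th}$ is the target secrecy rate. *)

theory Defs
  imports "HOL-Probability.Probability"
begin

definition uniform_rv :: "'a measure \<Rightarrow> ('a \<Rightarrow> real) \<Rightarrow> real \<Rightarrow> real \<Rightarrow> bool" where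
  "uniform_rv M X a b \<longleftrightarrow>
     distributed M lborel X (\<lambda>x. ennreal (indicator {a..b} x / measure lborel {a..b}))"

definition indep_coordinates ::
  "'a measure \<Rightarrow> ('a \<Rightarrow> real) \<Rightarrow> ('a \<Rightarrow> real) \<Rightarrow> ('a \<Rightarrow> real) \<Rightarrow> ('a \<Rightarrow> real) \<Rightarrow> bool" where
  "indep_coordinates M X1 Y1 X2 Y2 \<longleftrightarrow>
     prob_space.indep_vars M (\<lambda>_. borel) (\<lambda>i. [X1, Y1, X2, Y2] ! i) {..<4::nat}"

definition secrecy_outage_prob ::
  "'a measure \<Rightarrow> ('a \<Rightarrow> real) \<Rightarrow> ('a \<Rightarrow> real) \<Rightarrow> real \<Rightarrow> real" where
  "secrecy_outage_prob M \<gamma>B \<gamma>E Rth =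
     measure M {\<omega> \<in> space M. log 2 (1 + \<gamma>B \<omega>) - log 2 (1 + \<gamma>E \<omega>) \<le> Rth}"

end

theory Submission
  imports Defs
begin

text \<open>
  Since \<open>Rth \<ge> 0\<close>, outage is certain as soon as Eve is at least as close to the antenna as Bob.
  In the pinching system this event is \<open>(x1 - x2)\<^sup>2 + y2\<^sup>2 \<le> y1\<^sup>2\<close>, whose probability is computed
  exactly by Fubini: on \<open>[-a, a]\<close> with \<open>a = D / 2\<close>, \<open>\<bar>x1 - x2\<bar> \<le> r\<close> has probability
  \<open>r / a - r\<^sup>2 / (4 a\<^sup>2)\<close>; putting \<open>r = sqrt (y1\<^sup>2 - y2\<^sup>2)\<close> and averaging over \<open>y2\<close> and then \<open>y1\<close> gives
  \<open>(2 pi - 1) / 24\<close>. In the fixed-antenna system Bob and Eve are exchangeable, so the event that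
  Eve is at least as close as Bob has the same probability as its mirror image, and the two events
  cover the whole space.
\<close>

section \<open>Uniform laws and the joint law of independent coordinates\<close>

lemma uniform_rvD:
  assumes "uniform_rv M X a b" "a < b"
  shows "X \<in> borel_measurable M" "distr M borel X = uniform_measure lborel {a..b}"
proof -
  have d: "distributed M lborel X (\<lambda>x. ennreal (indicator {a..b} x / measure lborel {a..b}))"
    using assms by (simp add: uniform_rv_def)
  show "X \<in> borel_measurable M" using distributed_measurable[OF d] by simp
  have "distr M borel X = distr M lborel X" by (rule distr_cong) auto
  also have "\<dots> = density lborel (\<lambda>x. ennreal (indicator {a..b} x / measure lborel {a..b}))"
    by (rule distributed_distr_eq_density[OF d])
  \<comment> \<open>The density is a real quotient, whereas \<open>uniform_measure\<close> divides
    in the extended nonnegative reals; the two agree because \<open>b - a\<close> is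
    positive.\<close>
  also have "\<dots> = uniform_measure lborel {a..b}"
    unfolding uniform_measure_def
    by (intro density_cong) (use assms divide_ennreal[of 1 "b - a"] in \<open>auto simp: indicator_def\<close>)
  finally show "distr M borel X = uniform_measure lborel {a..b}" .
qed

text \<open>An injective \<open>p\<close> carries a finite subfamily of \<open>J\<close> to a finite
  subfamily of \<open>I\<close> without merging indices, so the product formula transfers. It is
  used to list the four coordinates in whatever order suits the integration, and to exchange Bob
  with Eve.\<close>

lemma indep_vars_perm:
  assumes "prob_space M" "prob_space.indep_vars M (\<lambda>_. N) X I" "inj_on p J" "p ` J \<subseteq> I"
  shows "prob_space.indep_vars M (\<lambda>_. N) (\<lambda>i. X (p i)) J"
proof -
  interpret prob_space M by fact
  let ?F = "\<lambda>i. {X i -` A \<inter> space M |A. A \<in> sets N}"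
  have iX: "indep_sets ?F I" and rv: "\<And>i. i \<in> I \<Longrightarrow> random_variable N (X i)"
    using assms(2) by (auto simp: indep_vars_def2)
  show ?thesis
    unfolding indep_vars_def2
  proof (intro conjI ballI indep_setsI)
    fix i assume "i \<in> J"
    then show "random_variable N (X (p i))" using assms(4) rv by auto
    then show "?F (p i) \<subseteq> events" by (auto intro: measurable_sets)
  next
    fix A K assume K: "K \<noteq> {}" "K \<subseteq> J" "finite K" and A: "\<forall>j\<in>K. A j \<in> ?F (p j)"
    have inj: "inj_on p K" using assms(3) K(2) by (rule inj_on_subset)
    have sub: "p ` K \<subseteq> I" using K(2) assms(4) by blast
    \<comment> \<open>The event chosen for the index \<open>p j\<close> is \<open>A j\<close>;
      \<open>inv_into\<close> recovers \<open>j\<close>, which is unique by injectivity.\<close>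
    have "prob (\<Inter>i\<in>p ` K. A (inv_into K p i)) = (\<Prod>i\<in>p ` K. prob (A (inv_into K p i)))"
      using K A inj sub by (intro indep_setsD[OF iX]) auto
    moreover have "(\<Inter>i\<in>p ` K. A (inv_into K p i)) = (\<Inter>j\<in>K. A j)" using inj by auto
    moreover have "(\<Prod>i\<in>p ` K. prob (A (inv_into K p i))) = (\<Prod>j\<in>K. prob (A j))"
      using inj by (simp add: prod.reindex)
    ultimately show "prob (\<Inter>j\<in>K. A j) = (\<Prod>j\<in>K. prob (A j))" by simp
  qed
qed

text \<open>Independence makes the joint law the product of the marginals, all equal to
  \<open>U\<close>, and Tonelli turns the expectation into an iterated integral in any order that is
  convenient.\<close>

lemma nn_integral_indep_vars4:
  assumes "prob_space M" "prob_space.indep_vars M (\<lambda>_. borel) X {..<4::nat}"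
    and D: "\<And>i. i < 4 \<Longrightarrow> distr M borel (X i) = U"
    and f: "(\<lambda>(a, b, c, d). f a b c d) \<in> borel_measurable (borel \<Otimes>\<^sub>M borel \<Otimes>\<^sub>M borel \<Otimes>\<^sub>M borel)"
  shows "(\<integral>\<^sup>+\<omega>. f (X 0 \<omega>) (X 1 \<omega>) (X 2 \<omega>) (X 3 \<omega>) \<partial>M)
    = (\<integral>\<^sup>+a. \<integral>\<^sup>+b. \<integral>\<^sup>+c. \<integral>\<^sup>+d. f a b c d \<partial>U \<partial>U \<partial>U \<partial>(U :: real measure))"
proof -
  interpret prob_space M by fact
  have X[measurable]: "random_variable borel (X i)" if "i < 4" for i
    using assms(2) that by (auto simp: indep_vars_def)
  have U: "prob_space U" using D[of 0] X[of 0] prob_space_distr[of "X 0" borel] by simp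
  have sU[measurable_cong]: "sets U = sets borel" by (subst D[of 0, symmetric]) auto
  interpret U: product_prob_space "\<lambda>_::nat. U" by (rule product_prob_spaceI) (rule U)
  let ?P = "PiM {..<4::nat} (\<lambda>_. U)"
  have eq: "distr M ?P (\<lambda>\<omega>. \<lambda>i\<in>{..<4}. X i \<omega>) = ?P"
  proof -
    \<comment> \<open>Only the sigma-algebra of the target matters for \<open>distr\<close>, so the
      factors \<open>U\<close> may be replaced by \<open>borel\<close>, where independence is
      characterised by the product law.\<close>
    have "distr M ?P (\<lambda>\<omega>. \<lambda>i\<in>{..<4}. X i \<omega>) = distr M (PiM {..<4} (\<lambda>_. borel)) (\<lambda>\<omega>. \<lambda>i\<in>{..<4}. X i \<omega>)"
      by (intro distr_cong sets_PiM_cong) (auto simp: sU)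
    also have "\<dots> = PiM {..<4} (\<lambda>i. distr M borel (X i))"
      using indep_vars_iff_distr_eq_PiM'[of "{..<4::nat}" X "\<lambda>_. borel"] assms(2) X by (simp add: lessThan_empty_iff)
    also have "\<dots> = ?P" by (intro PiM_cong) (auto simp: D)
    finally show ?thesis .
  qed
  let ?g = "\<lambda>x. f (x 0) (x 1) (x 2) (x 3)"
  have g: "(\<lambda>x. f (a x) (b x) (c x) (d x)) \<in> borel_measurable N"
    if [measurable]: "a \<in> borel_measurable N" "b \<in> borel_measurable N" "c \<in> borel_measurable N" "d \<in> borel_measurable N"
    for a b c d and N :: "'c measure"
    using measurable_compose[of "\<lambda>x. (a x, b x, c x, d x)" N, OF _ f] by simp
  have comp: "(\<lambda>x. x i) \<in> borel_measurable (PiM I (\<lambda>_. U))" if "i \<in> I" for i and I :: "nat set"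
    using measurable_component_singleton[OF that, of "\<lambda>_. U"] sU by (simp cong: measurable_cong_sets)
  have m: "?g \<in> borel_measurable ?P"
    by (intro g comp) auto
  have "(\<integral>\<^sup>+\<omega>. f (X 0 \<omega>) (X 1 \<omega>) (X 2 \<omega>) (X 3 \<omega>) \<partial>M) = (\<integral>\<^sup>+x. ?g x \<partial>distr M ?P (\<lambda>\<omega>. \<lambda>i\<in>{..<4}. X i \<omega>))"
    using X m by (subst nn_integral_distr) (auto intro!: measurable_restrict simp: measurable_cong_sets[OF refl sU])
  also have "\<dots> = (\<integral>\<^sup>+x. ?g x \<partial>?P)" by (simp add: eq)
  also have "{..<4::nat} = {0,1,2,3}" by auto
  also have "(\<integral>\<^sup>+x. ?g x \<partial>PiM {0::nat,1,2,3} (\<lambda>_. U)) =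
      (\<integral>\<^sup>+a. \<integral>\<^sup>+b. \<integral>\<^sup>+c. \<integral>\<^sup>+d. f a b c d \<partial>U \<partial>U \<partial>U \<partial>U)"
  proof -
    show ?thesis
      \<comment> \<open>Each inserted coordinate becomes the outermost integral, so coordinate 0
        ends up outside; what remains at the end is an integral over the one-point empty
        product.\<close>
      by (simp add: U.product_nn_integral_insert_rev PiM_empty nn_integral_count_space_finite g comp)
  qed
  finally show ?thesis .
qed

section \<open>Averages over \<open>[-a, a]\<close> and the constant
  \<open>(2 * pi - 1) / 24\<close>\<close>

text \<open>Monotonicity reduces the claim to the average of \<open>f\<close>, which an
  antiderivative supplies. As a lower bound it applies when \<open>g\<close> is an inner iterated
  integral whose measurability has not been established.\<close>

lemma uniform_nn_integral_ge:
  fixes f :: "real \<Rightarrow> real"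
  assumes "a < b" and f: "(f has_integral I) {a..b}" "continuous_on {a..b} f"
    and "\<And>x. x \<in> {a..b} \<Longrightarrow> 0 \<le> f x"
    and g: "\<And>x. x \<in> {a..b} \<Longrightarrow> ennreal (f x) \<le> g x"
  shows "ennreal (I / (b - a)) \<le> (\<integral>\<^sup>+x. g x \<partial>uniform_measure lborel {a..b})"
proof -
  let ?f = "\<lambda>x. f x * indicator {a..b} x"
  have m[measurable]: "?f \<in> borel_measurable borel"
    using borel_measurable_continuous_on_indicator[OF _ f(2)] by (simp add: mult.commute)
  have I: "0 \<le> I" using has_integral_nonneg[OF f(1)] assms(4) by auto
  have "(\<integral>\<^sup>+x. ennreal (?f x) * indicator {a..b} x \<partial>lborel) = (\<integral>\<^sup>+x. ennreal (f x) * indicator {a..b} x \<partial>lborel)"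
    by (intro nn_integral_cong) (auto simp: indicator_def)
  also have "\<dots> = ennreal I"
    using assms(4) f(1) by (rule nn_integral_has_integral_lebesgue')
  finally have "ennreal (I / (b - a)) = (\<integral>\<^sup>+x. ennreal (?f x) \<partial>uniform_measure lborel {a..b})"
    using assms(1) I by (subst nn_integral_uniform_measure) (auto simp: divide_ennreal)
  also have "\<dots> \<le> (\<integral>\<^sup>+x. g x \<partial>uniform_measure lborel {a..b})"
    using g by (intro nn_integral_mono) (auto simp: indicator_def)
  finally show ?thesis .
qed

lemma has_integral_semicircle:
  fixes u :: real
  assumes "0 \<le> u"
  shows "((\<lambda>v. sqrt (u\<^sup>2 - v\<^sup>2)) has_integral (pi * u\<^sup>2 / 2)) {-u..u}"
proof (cases "u = 0")
  case False
  with assms have u: "u > 0" by simp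
  \<comment> \<open>The classical antiderivative for the area under a semicircle. The interior form
    of the fundamental theorem is used because the square root and the arcsine are differentiated
    only where \<open>\<bar>v\<bar> < u\<close>.\<close>
  let ?F = "\<lambda>v. (v * sqrt (u\<^sup>2 - v\<^sup>2) + u\<^sup>2 * arcsin (v / u)) / 2"
  have "((\<lambda>v. sqrt (u\<^sup>2 - v\<^sup>2)) has_integral (?F u - ?F (-u))) {-u..u}"
  proof (rule fundamental_theorem_of_calculus_interior)
    show "continuous_on {-u..u} ?F"
      using u by (intro continuous_intros) (auto simp: field_simps)
    fix v assume v: "v \<in> {-u<..<u}"
    have s: "u\<^sup>2 - v\<^sup>2 > 0" using v u power_strict_mono[of "\<bar>v\<bar>" u 2] by auto
    have "sqrt (1 - (v / u)\<^sup>2) = sqrt ((u\<^sup>2 - v\<^sup>2) / u\<^sup>2)" using u by (simp add: field_simps)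
    also have "\<dots> = sqrt (u\<^sup>2 - v\<^sup>2) / u" using u by (simp add: real_sqrt_divide)
    finally have e: "sqrt (1 - (v / u)\<^sup>2) = sqrt (u\<^sup>2 - v\<^sup>2) / u" .
    let ?s = "sqrt (u\<^sup>2 - v\<^sup>2)"
    have s0: "?s > 0" and q: "?s * ?s = u\<^sup>2 - v\<^sup>2" using s by auto
    have 1: "((\<lambda>v. sqrt (u\<^sup>2 - v\<^sup>2)) has_real_derivative (- v / ?s)) (at v)"
      using s by (auto intro!: derivative_eq_intros simp: field_simps)
    have "((\<lambda>v. arcsin (v / u)) has_real_derivative (inverse (sqrt (1 - (v / u)\<^sup>2)) * (1 / u))) (at v)"
      using v u by (intro DERIV_chain2[OF DERIV_arcsin]) (auto intro!: derivative_eq_intros simp: field_simps)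
    then have 2: "((\<lambda>v. arcsin (v / u)) has_real_derivative (1 / ?s)) (at v)"
      using u by (simp add: e)
    have "(?F has_real_derivative ((1 * ?s + (- v / ?s) * v + u\<^sup>2 * (1 / ?s)) / 2)) (at v)"
      by (intro DERIV_cdivide DERIV_add DERIV_mult DERIV_ident DERIV_cmult 1 2)
    \<comment> \<open>By \<open>q\<close>, \<open>u^2 - v^2\<close> is the square of
      \<open>?s\<close>, so the last two terms of the numerator add up to another
      \<open>?s\<close>.\<close>
    also have "(1 * ?s + (- v / ?s) * v + u\<^sup>2 * (1 / ?s)) / 2 = ?s"
      using s0 q by (simp add: field_simps power2_eq_square)
    finally have "(?F has_real_derivative ?s) (at v)" .
    then show "(?F has_vector_derivative sqrt (u\<^sup>2 - v\<^sup>2)) (at v)"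
      by (rule has_real_derivative_iff_has_vector_derivative[THEN iffD1])
  qed (use u in auto)
  then show ?thesis using u by (simp add: field_simps)
qed auto

text \<open>The band \<open>\<bar>x - y\<bar> \<le> r\<close> is the square of side
  \<open>2 * a\<close> without two right triangles of leg \<open>2 * a - r\<close>, so its share of
  the area is \<open>1 - (2 * a - r)^2 / (4 * a^2)\<close>.\<close>

lemma uniform_distance_prob_ge:
  fixes a r :: real
  assumes "0 < a" "0 \<le> r" "r \<le> 2 * a"
  shows "ennreal (r / a - r\<^sup>2 / (4 * a\<^sup>2)) \<le>
    (\<integral>\<^sup>+x. \<integral>\<^sup>+y. indicator {z. \<bar>z\<bar> \<le> r} (x - y) \<partial>uniform_measure lborel {-a..a} \<partial>uniform_measure lborel {-a..a})"
proof -
  \<comment> \<open>The share of \<open>[-a, a]\<close> covered by the window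
    \<open>[x - r, x + r]\<close>.\<close>
  define f where "f x = (min a (x + r) - max (- a) (x - r)) / (2 * a)" for x
  have inner: "ennreal (f x) \<le> (\<integral>\<^sup>+y. indicator {z. \<bar>z\<bar> \<le> r} (x - y) \<partial>uniform_measure lborel {-a..a})"
    if x: "x \<in> {-a..a}" for x
  proof -
    have "(\<integral>\<^sup>+y. indicator {z. \<bar>z\<bar> \<le> r} (x - y) \<partial>uniform_measure lborel {-a..a})
       = (\<integral>\<^sup>+y. indicator {x - r..x + r} y \<partial>uniform_measure lborel {-a..a})"
      by (intro nn_integral_cong) (auto simp: indicator_def)
    also have "\<dots> = emeasure lborel ({-a..a} \<inter> {x - r..x + r}) / emeasure lborel {-a..a}"
      by simp
    also have "{-a..a} \<inter> {x - r..x + r} = {max (-a) (x - r)..min a (x + r)}" by auto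
    also have "emeasure lborel \<dots> / emeasure lborel {-a..a} = ennreal (f x)"
      using x assms by (auto simp: f_def divide_ennreal)
    finally show ?thesis by simp
  qed
  have c: "((\<lambda>x. min a (x + r)) has_integral (2 * a * r - r\<^sup>2 / 2)) {-a..a}"
  proof -
    \<comment> \<open>The minimum switches from \<open>x + r\<close> to \<open>a\<close> at
      \<open>x = a - r\<close>, a point of \<open>[-a, a]\<close> because
      \<open>0 \<le> r \<le> 2 * a\<close>.\<close>
    have 1: "((\<lambda>x. x + r) has_integral ((a - r + r)\<^sup>2 / 2 - (- a + r)\<^sup>2 / 2)) {-a..a - r}"
      using assms by (intro fundamental_theorem_of_calculus)
        (auto intro!: derivative_eq_intros simp: has_real_derivative_iff_has_vector_derivative[symmetric])
    have 2: "((\<lambda>x. a) has_integral (a * r)) {a - r..a}"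
      using has_integral_const_real[of a "a - r" a] assms by (simp add: mult.commute)
    have "((\<lambda>x. min a (x + r)) has_integral (((a - r + r)\<^sup>2 / 2 - (- a + r)\<^sup>2 / 2) + a * r)) {-a..a}"
      using assms by (intro has_integral_combine[of _ "a - r"] has_integral_eq[OF _ 1] has_integral_eq[OF _ 2]) auto
    then show ?thesis by (rule has_integral_eq_rhs) (simp add: power2_eq_square field_simps)
  qed
  have d: "((\<lambda>x. - max (- a) (x - r)) has_integral (2 * a * r - r\<^sup>2 / 2)) {-a..a}"
  proof -
    \<comment> \<open>The lower end of the window mirrors the upper end under
      \<open>x \<mapsto> - x\<close>, so its integral follows from \<open>c\<close>.\<close>
    have "((\<lambda>x. min a (- x + r)) has_integral (2 * a * r - r\<^sup>2 / 2)) {-a..- (- a)}"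
      using c has_integral_reflect_real[of "\<lambda>x. min a (x + r)" _ a "- a"] by simp
    moreover have "min a (- x + r) = - max (- a) (x - r)" for x by auto
    ultimately show ?thesis by simp
  qed
  have I: "(f has_integral ((4 * a * r - r\<^sup>2) / (2 * a))) {-a..a}"
    unfolding f_def using has_integral_divide[OF has_integral_add[OF c d], of "2 * a"] by (simp add: mult.assoc)
  have "ennreal (((4 * a * r - r\<^sup>2) / (2 * a)) / (a - (- a))) \<le>
    (\<integral>\<^sup>+x. \<integral>\<^sup>+y. indicator {z. \<bar>z\<bar> \<le> r} (x - y) \<partial>uniform_measure lborel {-a..a} \<partial>uniform_measure lborel {-a..a})"
    using assms by (intro uniform_nn_integral_ge[OF _ I _ _ inner])
      (auto simp: f_def intro!: continuous_intros divide_nonneg_pos)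
  also have "((4 * a * r - r\<^sup>2) / (2 * a)) / (a - (- a)) = r / a - r\<^sup>2 / (4 * a\<^sup>2)"
    using assms by (simp add: field_simps power2_eq_square)
  finally show ?thesis .
qed

text \<open>For fixed \<open>v\<close> the condition says that \<open>x - y\<close> lies within the
  half-chord \<open>sqrt (u^2 - v^2)\<close> of 0. Averaging the band probability over
  \<open>v\<close> needs the half-disc area for its linear term and the integral of
  \<open>u^2 - v^2\<close> for its quadratic term.\<close>

lemma uniform_disc_prob_ge:
  fixes a u :: real
  assumes a: "0 < a" and u: "\<bar>u\<bar> \<le> a"
  shows "ennreal (pi * u\<^sup>2 / (4 * a\<^sup>2) - \<bar>u\<bar> ^ 3 / (6 * a ^ 3)) \<le>
    (\<integral>\<^sup>+v. \<integral>\<^sup>+x. \<integral>\<^sup>+y. indicator {(z, v). z\<^sup>2 + v\<^sup>2 \<le> u\<^sup>2} (x - y, v)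
      \<partial>uniform_measure lborel {-a..a} \<partial>uniform_measure lborel {-a..a} \<partial>uniform_measure lborel {-a..a})"
proof -
  \<comment> \<open>Truncation at 0 gives radius 0 when
    \<open>\<bar>v\<bar> > \<bar>u\<bar>\<close>: there \<open>f\<close> vanishes and is trivially a
    lower bound, while it stays continuous on all of \<open>[-a, a]\<close>.\<close>
  define r where "r v = sqrt (max 0 (u\<^sup>2 - v\<^sup>2))" for v
  define f where "f v = r v / a - (r v)\<^sup>2 / (4 * a\<^sup>2)" for v
  have r0: "0 \<le> r v" for v by (simp add: r_def)
  have ra: "r v \<le> a" for v
  proof -
    have "u\<^sup>2 \<le> a\<^sup>2" using u a abs_le_square_iff[of u a] by auto
    then have "max 0 (u\<^sup>2 - v\<^sup>2) \<le> a\<^sup>2" by (smt (verit) zero_le_power2)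
    then show ?thesis using a unfolding r_def by (intro real_le_lsqrt) auto
  qed
  have inner: "ennreal (f v) \<le> (\<integral>\<^sup>+x. \<integral>\<^sup>+y. indicator {(z, v). z\<^sup>2 + v\<^sup>2 \<le> u\<^sup>2} (x - y, v)
      \<partial>uniform_measure lborel {-a..a} \<partial>uniform_measure lborel {-a..a})" (is "_ \<le> ?R") for v
  proof (cases "v\<^sup>2 \<le> u\<^sup>2")
    case True
    have "(\<bar>z\<bar> \<le> r v) = (z\<^sup>2 + v\<^sup>2 \<le> u\<^sup>2)" for z
    proof -
      have "(\<bar>z\<bar> \<le> r v) = (z\<^sup>2 \<le> (r v)\<^sup>2)" using r0[of v] abs_le_square_iff[of z "r v"] by simp
      then show ?thesis using True by (auto simp: r_def)
    qed
    then have "?R = (\<integral>\<^sup>+x. \<integral>\<^sup>+y. indicator {z. \<bar>z\<bar> \<le> r v} (x - y) \<partial>uniform_measure lborel {-a..a} \<partial>uniform_measure lborel {-a..a})"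
      by (intro nn_integral_cong) (auto simp: indicator_def)
    then show ?thesis using uniform_distance_prob_ge[OF a r0[of v]] ra[of v] a by (simp add: f_def)
  qed (auto simp: f_def r_def)
  have f0: "0 \<le> f v" for v
  proof -
    have "r v * r v \<le> r v * (4 * a)" using r0[of v] ra[of v] a by (intro mult_left_mono) auto
    then show ?thesis using a by (simp add: f_def field_simps power2_eq_square)
  qed
  have c: "continuous_on {-a..a} f" unfolding f_def r_def using a by (intro continuous_intros) auto
  let ?I = "(pi * u\<^sup>2 / 2) / a - ((4 / 3) * \<bar>u\<bar> ^ 3) / (4 * a\<^sup>2)"
  have q: "((\<lambda>v. u\<^sup>2 - v\<^sup>2) has_integral ((4 / 3) * \<bar>u\<bar> ^ 3)) {-\<bar>u\<bar>..\<bar>u\<bar>}"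
  proof -
    have "((\<lambda>v. u\<^sup>2 - v\<^sup>2) has_integral ((u\<^sup>2 * \<bar>u\<bar> - \<bar>u\<bar> ^ 3 / 3) - (u\<^sup>2 * (-\<bar>u\<bar>) - (-\<bar>u\<bar>) ^ 3 / 3))) {-\<bar>u\<bar>..\<bar>u\<bar>}"
      by (intro fundamental_theorem_of_calculus)
        (auto intro!: derivative_eq_intros simp: has_real_derivative_iff_has_vector_derivative[symmetric])
    then show ?thesis by (rule has_integral_eq_rhs) (simp add: power3_eq_cube power2_eq_square)
  qed
  have "((\<lambda>v. sqrt (u\<^sup>2 - v\<^sup>2) / a - (u\<^sup>2 - v\<^sup>2) / (4 * a\<^sup>2)) has_integral ?I) {-\<bar>u\<bar>..\<bar>u\<bar>}"
    using has_integral_semicircle[of "\<bar>u\<bar>"] q by (intro has_integral_diff has_integral_divide) auto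
  then have "(f has_integral ?I) {-\<bar>u\<bar>..\<bar>u\<bar>}"
  proof (rule has_integral_eq[rotated])
    fix v assume "v \<in> {-\<bar>u\<bar>..\<bar>u\<bar>}"
    then have "v\<^sup>2 \<le> u\<^sup>2" by (intro abs_le_square_iff[THEN iffD1]) auto
    then show "sqrt (u\<^sup>2 - v\<^sup>2) / a - (u\<^sup>2 - v\<^sup>2) / (4 * a\<^sup>2) = f v" by (simp add: f_def r_def)
  qed
  then have I: "(f has_integral ?I) {-a..a}"
  proof (rule has_integral_on_superset)
    show "f v = 0" if "v \<notin> {-\<bar>u\<bar>..\<bar>u\<bar>}" for v
    proof -
      have "u\<^sup>2 \<le> v\<^sup>2" using that by (intro abs_le_square_iff[THEN iffD1]) auto
      then show ?thesis by (simp add: f_def r_def)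
    qed
  qed (use u in auto)
  have "ennreal (?I / (a - (- a))) \<le> (\<integral>\<^sup>+v. \<integral>\<^sup>+x. \<integral>\<^sup>+y. indicator {(z, v). z\<^sup>2 + v\<^sup>2 \<le> u\<^sup>2} (x - y, v)
      \<partial>uniform_measure lborel {-a..a} \<partial>uniform_measure lborel {-a..a} \<partial>uniform_measure lborel {-a..a})"
    using a f0 inner by (intro uniform_nn_integral_ge[OF _ I c]) auto
  also have "?I / (a - (- a)) = pi * u\<^sup>2 / (4 * a\<^sup>2) - \<bar>u\<bar> ^ 3 / (6 * a ^ 3)"
    using a by (simp add: field_simps power2_eq_square power3_eq_cube)
  finally show ?thesis .
qed

text \<open>The last average, over \<open>u\<close>, of the disc bound. The variables stand for
  Bob's \<open>y1\<close>, Eve's \<open>y2\<close>, then \<open>x1\<close> and \<open>x2\<close>, so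
  that the radius is fixed before the horizontal distance is integrated.\<close>

lemma uniform_cone_prob_ge:
  fixes a :: real
  assumes a: "0 < a"
  shows "ennreal ((2 * pi - 1) / 24) \<le>
    (\<integral>\<^sup>+u. \<integral>\<^sup>+v. \<integral>\<^sup>+x. \<integral>\<^sup>+y. indicator {(u, v, x, y). (x - y)\<^sup>2 + v\<^sup>2 \<le> u\<^sup>2} (u, v, x, y)
      \<partial>uniform_measure lborel {-a..a} \<partial>uniform_measure lborel {-a..a} \<partial>uniform_measure lborel {-a..a} \<partial>uniform_measure lborel {-a..a})"
proof -
  define f where "f u = pi * u\<^sup>2 / (4 * a\<^sup>2) - \<bar>u\<bar> ^ 3 / (6 * a ^ 3)" for u
  have pos: "((\<lambda>u. pi * u\<^sup>2 / (4 * a\<^sup>2) - u ^ 3 / (6 * a ^ 3)) has_integral ((2 * pi - 1) / 24 * a)) {0..a}"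
  proof -
    let ?F = "\<lambda>u. pi * u ^ 3 / (12 * a\<^sup>2) - u ^ 4 / (24 * a ^ 3)"
    have "((\<lambda>u. pi * u\<^sup>2 / (4 * a\<^sup>2) - u ^ 3 / (6 * a ^ 3)) has_integral (?F a - ?F 0)) {0..a}"
      using a by (intro fundamental_theorem_of_calculus)
        (auto intro!: derivative_eq_intros simp: has_real_derivative_iff_has_vector_derivative[symmetric] field_simps)
    then show ?thesis
      by (rule has_integral_eq_rhs) (use a in \<open>simp add: field_simps eval_nat_numeral\<close>)
  qed
  have p: "(f has_integral ((2 * pi - 1) / 24 * a)) {0..a}"
    by (rule has_integral_eq[OF _ pos]) (auto simp: f_def)
  \<comment> \<open>\<open>f\<close> is even, so the half with \<open>\<bar>u\<bar> = u\<close>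
    determines the other one.\<close>
  have "((\<lambda>u. f (- u)) has_integral ((2 * pi - 1) / 24 * a)) {-a..-0}"
    using p by (subst has_integral_reflect_real) auto
  then have n: "(f has_integral ((2 * pi - 1) / 24 * a)) {-a..0}" by (simp add: f_def[abs_def])
  have I: "(f has_integral ((2 * pi - 1) / 24 * a + (2 * pi - 1) / 24 * a)) {-a..a}"
    using a by (intro has_integral_combine[OF _ _ n p]) auto
  have c: "continuous_on {-a..a} f" unfolding f_def using a by (intro continuous_intros) auto
  have f0: "0 \<le> f u" if "u \<in> {-a..a}" for u
  proof -
    \<comment> \<open>Since \<open>\<bar>u\<bar> \<le> a\<close>, the cubic term is at most 2/3 of
      \<open>u^2 / (4 * a^2)\<close>, and 2/3 is below \<open>pi\<close>.\<close>
    have "\<bar>u\<bar> ^ 3 = u\<^sup>2 * \<bar>u\<bar>" by (simp add: power3_eq_cube power2_eq_square)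
    also have "\<dots> \<le> u\<^sup>2 * a" using that by (intro mult_left_mono) auto
    finally have "\<bar>u\<bar> ^ 3 / (6 * a ^ 3) \<le> u\<^sup>2 * a / (6 * a ^ 3)" using a by (intro divide_right_mono) auto
    also have "\<dots> = u\<^sup>2 / (4 * a\<^sup>2) * (2 / 3)" using a by (simp add: field_simps power3_eq_cube power2_eq_square)
    also have "\<dots> \<le> u\<^sup>2 / (4 * a\<^sup>2) * pi" using pi_ge_two by (intro mult_left_mono) auto
    finally show ?thesis by (simp add: f_def mult.commute)
  qed
  have "ennreal (((2 * pi - 1) / 24 * a + (2 * pi - 1) / 24 * a) / (a - (- a))) \<le>
    (\<integral>\<^sup>+u. \<integral>\<^sup>+v. \<integral>\<^sup>+x. \<integral>\<^sup>+y. indicator {(u, v, x, y). (x - y)\<^sup>2 + v\<^sup>2 \<le> u\<^sup>2} (u, v, x, y)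
      \<partial>uniform_measure lborel {-a..a} \<partial>uniform_measure lborel {-a..a} \<partial>uniform_measure lborel {-a..a} \<partial>uniform_measure lborel {-a..a})"
  proof (rule uniform_nn_integral_ge[OF _ I c f0])
    fix u assume "u \<in> {-a..a}"
    then show "ennreal (f u) \<le> (\<integral>\<^sup>+v. \<integral>\<^sup>+x. \<integral>\<^sup>+y. indicator {(u, v, x, y). (x - y)\<^sup>2 + v\<^sup>2 \<le> u\<^sup>2} (u, v, x, y)
      \<partial>uniform_measure lborel {-a..a} \<partial>uniform_measure lborel {-a..a} \<partial>uniform_measure lborel {-a..a})"
      using uniform_disc_prob_ge[OF a, of u] by (auto simp: f_def indicator_def)
  qed (use a in auto)
  also have "((2 * pi - 1) / 24 * a + (2 * pi - 1) / 24 * a) / (a - (- a)) = (2 * pi - 1) / 24"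
    using a by (simp add: field_simps)
  finally show ?thesis .
qed

section \<open>Outage events and the two bounds\<close>

text \<open>With \<open>s\<close> and \<open>t\<close> the squared distances of Eve and Bob, a
  closer Eve has the larger rate, so the difference is at most 0 and hence at most
  \<open>R\<close>.\<close>

lemma snr_diff_le:
  fixes s t g R :: real
  assumes "0 < s" "s \<le> t" "0 < g" "0 \<le> R"
  shows "log 2 (1 + g / t) - log 2 (1 + g / s) \<le> R"
proof -
  have "log 2 (1 + g / t) \<le> log 2 (1 + g / s)"
    using assms by (intro log_mono add_left_mono divide_left_mono add_pos_pos) auto
  then show ?thesis using assms by simp
qed

theorem theorem2:
  fixes M :: "'a measure" and x1 y1 x2 y2 :: "'a \<Rightarrow> real" and D h gbar Rth :: real
  assumes "prob_space M"
    and "D > 0" and "h > 0" and "gbar > 0" and "Rth \<ge> 0"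
    and "uniform_rv M x1 (- D / 2) (D / 2)"
    and "uniform_rv M y1 (- D / 2) (D / 2)"
    and "uniform_rv M x2 (- D / 2) (D / 2)"
    and "uniform_rv M y2 (- D / 2) (D / 2)"
    and "indep_coordinates M x1 y1 x2 y2"
  shows "secrecy_outage_prob M
           (\<lambda>\<omega>. gbar / ((y1 \<omega>)\<^sup>2 + h\<^sup>2))
           (\<lambda>\<omega>. gbar / ((x1 \<omega> - x2 \<omega>)\<^sup>2 + (y2 \<omega>)\<^sup>2 + h\<^sup>2)) Rth \<ge> (2 * pi - 1) / 24
       \<and> secrecy_outage_prob M
           (\<lambda>\<omega>. gbar / ((x1 \<omega>)\<^sup>2 + (y1 \<omega>)\<^sup>2 + h\<^sup>2))
           (\<lambda>\<omega>. gbar / ((x2 \<omega>)\<^sup>2 + (y2 \<omega>)\<^sup>2 + h\<^sup>2)) Rth \<ge> 1 / 2"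
proof -
  interpret prob_space M by fact
  define a where "a = D / 2"
  have a: "0 < a" and ab: "- D / 2 = - a" "D / 2 = a" using assms(2) by (auto simp: a_def)
  let ?U = "uniform_measure lborel {-a..a}"
  have meas[measurable]: "x1 \<in> borel_measurable M" "y1 \<in> borel_measurable M"
      "x2 \<in> borel_measurable M" "y2 \<in> borel_measurable M"
    using assms(6-9) a unfolding ab by (auto intro: uniform_rvD)
  have ui: "distr M borel x1 = ?U" "distr M borel y1 = ?U" "distr M borel x2 = ?U" "distr M borel y2 = ?U"
    using assms(6-9) a unfolding ab by (auto intro: uniform_rvD)
  have ind: "indep_vars (\<lambda>_. borel) (\<lambda>i. [x1, y1, x2, y2] ! i) {..<4::nat}"
    using assms(10) by (simp add: indep_coordinates_def)
  \<comment> \<open>The right-hand side does not depend on the ordering \<open>p\<close>: all four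
    marginals are the same uniform law. This yields both a free choice of integration order and the
    exchangeability of Bob and Eve.\<close>
  have joint: "emeasure M {\<omega> \<in> space M. (X 0 \<omega>, X 1 \<omega>, X 2 \<omega>, X 3 \<omega>) \<in> S} =
      (\<integral>\<^sup>+a. \<integral>\<^sup>+b. \<integral>\<^sup>+c. \<integral>\<^sup>+d. indicator S (a, b, c, d) \<partial>?U \<partial>?U \<partial>?U \<partial>?U)"
    if p: "set p = {..<4}" "distinct p" "length p = 4" "\<And>i. X i = [x1, y1, x2, y2] ! (p ! i)"
      and S: "S \<in> sets (borel \<Otimes>\<^sub>M borel \<Otimes>\<^sub>M borel \<Otimes>\<^sub>M borel)" for p :: "nat list" and X S
  proof -
    have "indep_vars (\<lambda>_. borel) (\<lambda>i. [x1, y1, x2, y2] ! (p ! i)) {..<4::nat}"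
      using p by (intro indep_vars_perm[OF assms(1) ind]) (auto simp: inj_on_nth nth_mem set_conv_nth)
    then have iX: "indep_vars (\<lambda>_. borel) X {..<4}" using p(4) by (simp cong: indep_vars_cong)
    have dX: "distr M borel (X i) = ?U" if "i < 4" for i
    proof -
      have "p ! i < 4" using p that nth_mem[of i p] by auto
      then show ?thesis using ui unfolding p(4) by (auto simp: less_Suc_eq eval_nat_numeral)
    qed
    have [measurable]: "random_variable borel (X i)" if "i < 4" for i
      using iX that by (auto simp: indep_vars_def)
    note [measurable] = S
    have "emeasure M {\<omega> \<in> space M. (X 0 \<omega>, X 1 \<omega>, X 2 \<omega>, X 3 \<omega>) \<in> S} =
       (\<integral>\<^sup>+\<omega>. indicator {\<omega> \<in> space M. (X 0 \<omega>, X 1 \<omega>, X 2 \<omega>, X 3 \<omega>) \<in> S} \<omega> \<partial>M)"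
      by (intro nn_integral_indicator[symmetric]) measurable
    also have "\<dots> = (\<integral>\<^sup>+\<omega>. indicator S (X 0 \<omega>, X 1 \<omega>, X 2 \<omega>, X 3 \<omega>) \<partial>M)"
      by (intro nn_integral_cong) (auto simp: indicator_def)
    also have "\<dots> = (\<integral>\<^sup>+a. \<integral>\<^sup>+b. \<integral>\<^sup>+c. \<integral>\<^sup>+d. indicator S (a, b, c, d) \<partial>?U \<partial>?U \<partial>?U \<partial>?U)"
      by (rule nn_integral_indep_vars4[OF assms(1) iX dX]) (auto simp: split_beta')
    finally show ?thesis .
  qed
  have "(2 * pi - 1) / 24 \<le> measure M {\<omega> \<in> space M. (x1 \<omega> - x2 \<omega>)\<^sup>2 + (y2 \<omega>)\<^sup>2 \<le> (y1 \<omega>)\<^sup>2}"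
  proof -
    let ?S = "{(u, v, x, y). (x - y)\<^sup>2 + v\<^sup>2 \<le> u\<^sup>2} :: (real \<times> real \<times> real \<times> real) set"
    have S: "?S \<in> sets (borel \<Otimes>\<^sub>M borel \<Otimes>\<^sub>M borel \<Otimes>\<^sub>M borel)"
      unfolding borel_prod case_prod_beta by (intro borel_closed closed_Collect_le continuous_intros)
    have "{\<omega> \<in> space M. (x1 \<omega> - x2 \<omega>)\<^sup>2 + (y2 \<omega>)\<^sup>2 \<le> (y1 \<omega>)\<^sup>2} = {\<omega> \<in> space M. (y1 \<omega>, y2 \<omega>, x1 \<omega>, x2 \<omega>) \<in> ?S}"
      by auto
    moreover have "ennreal ((2 * pi - 1) / 24) \<le> emeasure M {\<omega> \<in> space M. (y1 \<omega>, y2 \<omega>, x1 \<omega>, x2 \<omega>) \<in> ?S}"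
      \<comment> \<open>The list \<open>[1,3,0,2]\<close> orders the coordinates as
        \<open>y1\<close>, \<open>y2\<close>, \<open>x1\<close>, \<open>x2\<close>, matching the
        cone integral.\<close>
      using uniform_cone_prob_ge[OF a] joint[of "[1,3,0,2]" "\<lambda>i. [x1, y1, x2, y2] ! ([1,3,0,2] ! i)", OF _ _ _ refl S]
      by (simp add: numeral_eq_Suc lessThan_Suc insert_commute)
    ultimately show ?thesis
      by (simp add: emeasure_eq_measure ennreal_le_iff)
  qed
  also have "\<dots> \<le> secrecy_outage_prob M
           (\<lambda>\<omega>. gbar / ((y1 \<omega>)\<^sup>2 + h\<^sup>2))
           (\<lambda>\<omega>. gbar / ((x1 \<omega> - x2 \<omega>)\<^sup>2 + (y2 \<omega>)\<^sup>2 + h\<^sup>2)) Rth"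
    unfolding secrecy_outage_prob_def
    \<comment> \<open>Adding \<open>h^2\<close> to both sides of the event compares the squared
      distances to the antenna and keeps them positive, as \<open>snr_diff_le\<close>
      requires.\<close>
    using assms(3-5) by (intro finite_measure_mono) (auto intro!: snr_diff_le add_nonneg_pos)
  finally have pinching: "(2 * pi - 1) / 24 \<le> secrecy_outage_prob M
           (\<lambda>\<omega>. gbar / ((y1 \<omega>)\<^sup>2 + h\<^sup>2))
           (\<lambda>\<omega>. gbar / ((x1 \<omega> - x2 \<omega>)\<^sup>2 + (y2 \<omega>)\<^sup>2 + h\<^sup>2)) Rth" .
  let ?A = "{\<omega> \<in> space M. (x2 \<omega>)\<^sup>2 + (y2 \<omega>)\<^sup>2 \<le> (x1 \<omega>)\<^sup>2 + (y1 \<omega>)\<^sup>2}"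
  let ?B = "{\<omega> \<in> space M. (x1 \<omega>)\<^sup>2 + (y1 \<omega>)\<^sup>2 \<le> (x2 \<omega>)\<^sup>2 + (y2 \<omega>)\<^sup>2}"
  have "prob ?A = prob ?B"
  proof -
    let ?S = "{(x, y, x', y'). x'\<^sup>2 + y'\<^sup>2 \<le> x\<^sup>2 + y\<^sup>2} :: (real \<times> real \<times> real \<times> real) set"
    have S: "?S \<in> sets (borel \<Otimes>\<^sub>M borel \<Otimes>\<^sub>M borel \<Otimes>\<^sub>M borel)"
      unfolding borel_prod case_prod_beta by (intro borel_closed closed_Collect_le continuous_intros)
    have "?A = {\<omega> \<in> space M. (x1 \<omega>, y1 \<omega>, x2 \<omega>, y2 \<omega>) \<in> ?S}"
      "?B = {\<omega> \<in> space M. (x2 \<omega>, y2 \<omega>, x1 \<omega>, y1 \<omega>) \<in> ?S}" by auto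
    moreover have "emeasure M {\<omega> \<in> space M. (x1 \<omega>, y1 \<omega>, x2 \<omega>, y2 \<omega>) \<in> ?S} =
        emeasure M {\<omega> \<in> space M. (x2 \<omega>, y2 \<omega>, x1 \<omega>, y1 \<omega>) \<in> ?S}"
      \<comment> \<open>The list \<open>[2,3,0,1]\<close> swaps the two users, so both events have
        the same iterated integral over \<open>?S\<close>.\<close>
      using joint[of "[0,1,2,3]" "\<lambda>i. [x1, y1, x2, y2] ! ([0,1,2,3] ! i)", OF _ _ _ refl S]
        joint[of "[2,3,0,1]" "\<lambda>i. [x1, y1, x2, y2] ! ([2,3,0,1] ! i)", OF _ _ _ refl S]
      by (simp add: numeral_eq_Suc lessThan_Suc insert_commute)
    ultimately show ?thesis by (simp add: emeasure_eq_measure)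
  qed
  moreover have "1 \<le> prob ?A + prob ?B"
  proof -
    \<comment> \<open>Squared distances are totally ordered; ties lie in both events, which is
      harmless for the union bound.\<close>
    have "space M = ?A \<union> ?B" by auto
    then have "1 = prob (?A \<union> ?B)" using prob_space by simp
    also have "\<dots> \<le> prob ?A + prob ?B" by (intro measure_Un_le) measurable
    finally show ?thesis .
  qed
  ultimately have "1 / 2 \<le> prob ?A" by simp
  also have "\<dots> \<le> secrecy_outage_prob M
           (\<lambda>\<omega>. gbar / ((x1 \<omega>)\<^sup>2 + (y1 \<omega>)\<^sup>2 + h\<^sup>2))
           (\<lambda>\<omega>. gbar / ((x2 \<omega>)\<^sup>2 + (y2 \<omega>)\<^sup>2 + h\<^sup>2)) Rth"
    unfolding secrecy_outage_prob_def
    using assms(3-5) by (intro finite_measure_mono) (auto intro!: snr_diff_le add_nonneg_pos)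
  finally show ?thesis using pinching by simp
qed

end
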